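(* Let $0<\varepsilon<1/2$ and consider the sequential hypothesis testing problem of deciding between $H_0: p=1/2-\varepsilon$ and $H_1: p=1/2+\varepsilon$. For every $\beta>0$ there exists an integer $c=c(\beta)\ge 0$ such that the linear policy $\mathcal{P}_c$ with threshold $c$, with profile $(\delta_c^+,\delta_c^-,H_c^+,H_c^-)$, satisfies the following: for any other policy $\mathcal{P}$, with profile $(\delta^+,\delta^-,H^+,H^-)$, $$(\delta_c^+ + \delta_c^-) + \beta\,(H_c^+ + H_c^-) \;\le\; (\delta^+ + \delta^-) + \beta\,(H^+ + H^-).$$
   Context: A coin with unknown heads probability $p\in\{1/2-\varepsilon,\,1/2+\varepsilon\}$ is tossed independently and repeatedly. The state $(h,t)\in\mathbb{Z}_{\ge 0}^2$ records the numbers of heads $h$ and tails $t$ observed so far, starting at $(0,0)$; each toss increases $h$ by 1 with probability $p$ and increases $t$ by 1 with probability $1-p$. A policy is a coloring of $\mathbb{Z}_{\ge 0}^2$ with the colors white, blue and red: at a white cell the policy tosses again; at a blue cell it stops and predicts $1/2+\varepsilon$; at a red cell it stops and predicts $1/2-\varepsilon$. Only policies with finite expected number of tosses (under both values of $p$) are considered. The profile of a policy $\mathcal{P}$ consists of $\delta^+=\Pr_{1/2+\varepsilon}[\mathcal{P}\text{ predicts }1/2-\varepsilon]$, $\delta^-=\Pr_{1/2-\varepsilon}[\mathcal{P}\text{ predicts }1/2+\varepsilon]$, $H^+=\mathbb{E}_{1/2+\varepsilon}[\#\text{ tosses by }\mathcal{P}]$, $H^-=\mathbb{E}_{1/2-\varepsilon}[\#\text{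 tosses by }\mathcal{P}]$, where the subscript is the true value of $p$. For an integer $c\ge 0$, the linear policy $\mathcal{P}_c$ stops the first time $|h-t|=c$, and predicts $1/2+\varepsilon$ if $h>t$ at that time and $1/2-\varepsilon$ otherwise. (For $c=0$ it stops immediately at $(0,0)$ without tossing.) The threshold $c$ may depend on $\varepsilon$ (which is fixed and known) as well as on $\beta$. *)

theory Defs
  imports "HOL-Probability.Probability"
begin

datatype color = White | Blue | Red

text \<open>A policy colors the cell with \<^term>\<open>h\<close> heads and \<^term>\<open>t\<close> tails: \<^term>\<open>White\<close> means toss again,
  \<^term>\<open>Blue\<close> means stop and predict \<open>1/2 + \<epsilon>\<close>, \<^term>\<open>Red\<close> means stop and predict \<open>1/2 - \<epsilon>\<close>.\<close>

type_synonym policy = "nat \<Rightarrow> nat \<Rightarrow> color"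

text \<open>Independent tosses of a coin with heads probability \<open>p\<close>; \<^term>\<open>True\<close> encodes heads.\<close>

definition coin_tosses :: "real \<Rightarrow> bool stream measure" where
  "coin_tosses p = stream_space (measure_pmf (bernoulli_pmf p))"

definition heads :: "nat \<Rightarrow> bool stream \<Rightarrow> nat" where
  "heads n \<omega> = count_list (stake n \<omega>) True"

definition tails :: "nat \<Rightarrow> bool stream \<Rightarrow> nat" where
  "tails n \<omega> = count_list (stake n \<omega>) False"

definition color_at :: "policy \<Rightarrow> nat \<Rightarrow> bool stream \<Rightarrow> color" where
  "color_at P n \<omega> = P (heads n \<omega>) (tails n \<omega>)"

definition stops_at :: "policy \<Rightarrow> nat \<Rightarrow> bool stream \<Rightarrow> bool" where
  "stops_at P n \<omega> \<longleftrightarrow> color_at P n \<omega> \<noteq> White \<and> (\<forall>m<n. color_at P m \<omega> = White)"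

text \<open>The infimum is \<^term>\<open>\<infinity> :: enat\<close> on toss sequences on which the policy never stops.\<close>

definition num_tosses :: "policy \<Rightarrow> bool stream \<Rightarrow> enat" where
  "num_tosses P \<omega> = (INF n\<in>{n. color_at P n \<omega> \<noteq> White}. enat n)"

definition predicts_plus :: "policy \<Rightarrow> bool stream \<Rightarrow> bool" where
  "predicts_plus P \<omega> \<longleftrightarrow> (\<exists>n. stops_at P n \<omega> \<and> color_at P n \<omega> = Blue)"

definition predicts_minus :: "policy \<Rightarrow> bool stream \<Rightarrow> bool" where
  "predicts_minus P \<omega> \<longleftrightarrow> (\<exists>n. stops_at P n \<omega> \<and> color_at P n \<omega> = Red)"

definition expected_tosses :: "real \<Rightarrow> policy \<Rightarrow> ennreal" where
  "expected_tosses p P = (\<integral>\<^sup>+ \<omega>. ennreal_of_enat (num_tosses P \<omega>) \<partial>coin_tosses p)"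

definition admissible :: "real \<Rightarrow> policy \<Rightarrow> bool" where
  "admissible \<epsilon> P \<longleftrightarrow>
     expected_tosses (1/2 + \<epsilon>) P < \<infinity> \<and> expected_tosses (1/2 - \<epsilon>) P < \<infinity>"

text \<open>The profile of a policy. Note that \<^term>\<open>enn2real\<close> sends \<^term>\<open>\<infinity> :: ennreal\<close> to \<open>0\<close>, so \<open>H_plus\<close> and
  \<open>H_minus\<close> are meaningful only for admissible policies.\<close>

definition delta_plus :: "real \<Rightarrow> policy \<Rightarrow> real" where
  "delta_plus \<epsilon> P = \<P>(\<omega> in coin_tosses (1/2 + \<epsilon>). predicts_minus P \<omega>)"

definition delta_minus :: "real \<Rightarrow> policy \<Rightarrow> real" where
  "delta_minus \<epsilon> P = \<P>(\<omega> in coin_tosses (1/2 - \<epsilon>). predicts_plus P \<omega>)"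

definition H_plus :: "real \<Rightarrow> policy \<Rightarrow> real" where
  "H_plus \<epsilon> P = enn2real (expected_tosses (1/2 + \<epsilon>) P)"

definition H_minus :: "real \<Rightarrow> policy \<Rightarrow> real" where
  "H_minus \<epsilon> P = enn2real (expected_tosses (1/2 - \<epsilon>) P)"

text \<open>Cells with \<open>\<bar>h - t\<bar> > c\<close> are unreachable, as \<open>h - t\<close> starts at \<open>0\<close> and moves in unit steps;
  their color is irrelevant. For \<open>c = 0\<close> the policy stops at once and predicts \<open>1/2 - \<epsilon>\<close>.\<close>

definition linear_policy :: "nat \<Rightarrow> policy" where
  "linear_policy c h t =
     (if \<bar>int h - int t\<bar> = int c then (if h > t then Blue else Red) else White)"

text \<open>The events and random variables above are measurable, and
  \<open>num_tosses\<close> is the stopping time described by \<open>stops_at\<close>.\<close>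

lemma measurable_color_at [measurable]:
  "color_at P n \<in> coin_tosses p \<rightarrow>\<^sub>M count_space UNIV"
proof -
  have [measurable]: "stake n \<in> coin_tosses p \<rightarrow>\<^sub>M count_space UNIV"
    unfolding coin_tosses_def
    by (subst measurable_cong_sets[OF sets_stream_space_cong[OF sets_measure_pmf_count_space] refl])
       (rule measurable_stake)
  have "(\<lambda>\<omega>. (\<lambda>xs. P (count_list xs True) (count_list xs False)) (stake n \<omega>))
          \<in> coin_tosses p \<rightarrow>\<^sub>M count_space UNIV"
    by measurable
  then show ?thesis
    by (simp add: color_at_def[abs_def] heads_def tails_def)
qed

lemma measurable_stops_at [measurable]: "Measurable.pred (coin_tosses p) (stops_at P n)"
  unfolding stops_at_def[abs_def] by measurable

lemma measurable_predicts [measurable]: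
  "Measurable.pred (coin_tosses p) (predicts_plus P)"
  "Measurable.pred (coin_tosses p) (predicts_minus P)"
  unfolding predicts_plus_def[abs_def] predicts_minus_def[abs_def] by measurable

lemma num_tosses_eq_enat_iff: "num_tosses P \<omega> = enat n \<longleftrightarrow> stops_at P n \<omega>"
proof -
  let ?S = "{n. color_at P n \<omega> \<noteq> White}"
  have stop: "num_tosses P \<omega> = enat k" if "stops_at P k \<omega>" for k
    unfolding num_tosses_def
  proof (rule antisym)
    show "(INF n\<in>?S. enat n) \<le> enat k"
      using that by (intro INF_lower) (auto simp: stops_at_def)
    show "enat k \<le> (INF n\<in>?S. enat n)"
      using that by (intro INF_greatest) (auto simp: stops_at_def not_less[symmetric])
  qed
  show ?thesis
  proof
    assume eq: "num_tosses P \<omega> = enat n"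
    have "?S \<noteq> {}"
    proof
      assume "?S = {}"
      then have "num_tosses P \<omega> = \<infinity>"
        unfolding num_tosses_def by (simp only: image_empty Inf_empty top_enat_def)
      with eq show False by simp
    qed
    then obtain j where j: "color_at P j \<omega> \<noteq> White"
      by auto
    define k where "k = (LEAST k. color_at P k \<omega> \<noteq> White)"
    have "stops_at P k \<omega>"
      unfolding stops_at_def k_def
      using LeastI[of "\<lambda>k. color_at P k \<omega> \<noteq> White", OF j] not_less_Least by blast
    with stop[of k] eq show "stops_at P n \<omega>"
      by simp
  qed (rule stop)
qed

lemma measurable_num_tosses [measurable]:
  "num_tosses P \<in> coin_tosses p \<rightarrow>\<^sub>M count_space UNIV"
proof (subst measurable_count_space_eq2_countable, safe)
  fix a :: enat
  show "num_tosses P -` {a} \<inter> space (coin_tosses p) \<in> sets (coin_tosses p)"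
  proof (cases a)
    case (enat n)
    have "num_tosses P -` {a} \<inter> space (coin_tosses p) = {\<omega> \<in> space (coin_tosses p). stops_at P n \<omega>}"
      by (auto simp: enat num_tosses_eq_enat_iff)
    then show ?thesis by simp
  next
    case infinity
    have "num_tosses P -` {a} \<inter> space (coin_tosses p) =
        {\<omega> \<in> space (coin_tosses p). \<forall>n. \<not> stops_at P n \<omega>}"
      by (auto simp: infinity num_tosses_eq_enat_iff[symmetric])
    then show ?thesis by simp
  qed
qed auto

end

theory Submission
  imports Defs
begin

text \<open>
  Under the true value \<open>1/2 \<plusminus> \<epsilon>\<close> the difference \<open>d = h - t\<close> drifts by \<open>\<plusminus>2\<epsilon>\<close> per toss, so by Wald's
  identity \<open>H\<^sup>+ + H\<^sup>-\<close> equals \<open>1/(2\<epsilon>)\<close> times the sum of \<open>d (w\<^sup>+ - w\<^sup>-)\<close> over the toss prefixes at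
  which the policy stops, where \<open>w\<^sup>\<plusminus>\<close> are the two probabilities of the prefix. The objective thereby
  becomes a sum over stopping prefixes, and the term of each prefix is at least
  \<open>A(\<bar>d\<bar>) (w\<^sup>+ + w\<^sup>-)\<close> for an explicit function \<open>A\<close>, with equality if the prediction is the more
  likely one. The stopping prefixes have total weight \<open>2\<close>, so the objective is at least \<open>2 min A\<close>,
  and the linear policy with threshold \<open>c\<close> attains exactly \<open>2 A(c)\<close>.

  All sums are truncated at \<open>n\<close> tosses; the boundary term of Wald's identity is nonnegative, and
  for a linear policy it is at most a constant times the weight of the prefixes that are still
  running.
\<close>

section \<open>Finite toss prefixes and optional stopping\<close>

definition prefix_prob :: "real \<Rightarrow> bool list \<Rightarrow> real" where
  "prefix_prob p xs = p ^ count_list xs True * (1 - p) ^ count_list xs False"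

definition prefix_color :: "policy \<Rightarrow> bool list \<Rightarrow> color" where
  "prefix_color P xs = P (count_list xs True) (count_list xs False)"

text \<open>The cell at time \<open>n\<close> itself must be white, so \<open>live P n\<close> is
  the event that more than \<open>n\<close> tosses are made.\<close>

definition live :: "policy \<Rightarrow> nat \<Rightarrow> bool list set" where
  "live P n = {xs. length xs = n \<and> (\<forall>m\<le>n. prefix_color P (take m xs) = White)}"

definition stopped :: "policy \<Rightarrow> nat \<Rightarrow> bool list set" where
  "stopped P n = {xs. length xs = n \<and> prefix_color P xs \<noteq> White \<and>
     (\<forall>m<n. prefix_color P (take m xs) = White)}"

lemma finite_lists_of_length: "finite {xs :: 'a::finite list. length xs = n}"
  using finite_lists_length_eq[of "UNIV :: 'a set" n] by simp

lemma finite_live [simp]: "finite (live P n)"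
  by (rule finite_subset[OF _ finite_lists_of_length[of n]]) (auto simp: live_def)

lemma finite_stopped [simp]: "finite (stopped P n)"
  by (rule finite_subset[OF _ finite_lists_of_length[of n]]) (auto simp: stopped_def)

lemma live_stopped_disjoint: "live P n \<inter> stopped P n = {}"
  by (auto simp: live_def stopped_def)

lemma live_stopped_0: "live P 0 \<union> stopped P 0 = {[]}"
  by (auto simp: live_def stopped_def)

text \<open>A policy that has not stopped after \<open>n\<close> tosses makes one more toss, and
  only the color of the cell reached then decides between running on and stopping.\<close>

lemma live_stopped_Suc:
  "live P (Suc n) \<union> stopped P (Suc n) = (\<lambda>(xs, b). xs @ [b]) ` (live P n \<times> UNIV)"
proof (intro equalityI subsetI)
  fix ys assume ys: "ys \<in> live P (Suc n) \<union> stopped P (Suc n)"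
  then have len: "length ys = Suc n" and w: "\<forall>m<Suc n. prefix_color P (take m ys) = White"
    by (auto simp: live_def stopped_def)
  from len obtain xs b where eq: "ys = xs @ [b]" and n: "length xs = n"
    by (metis length_Suc_conv_rev)
  have "prefix_color P (take m xs) = White" if "m \<le> n" for m
    using w[rule_format, of m] that n by (simp add: eq)
  then have "xs \<in> live P n" using n by (simp add: live_def)
  then show "ys \<in> (\<lambda>(xs, b). xs @ [b]) ` (live P n \<times> UNIV)" by (auto simp: eq)
next
  fix ys assume "ys \<in> (\<lambda>(xs, b). xs @ [b]) ` (live P n \<times> UNIV)"
  then obtain xs b where eq: "ys = xs @ [b]" and xs: "xs \<in> live P n" by auto
  then show "ys \<in> live P (Suc n) \<union> stopped P (Suc n)"
    by (auto simp: live_def stopped_def le_Suc_eq)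
qed

lemma sum_live_stopped_Suc:
  fixes F :: "bool list \<Rightarrow> real"
  shows "sum F (live P (Suc n)) + sum F (stopped P (Suc n)) =
    (\<Sum>xs\<in>live P n. F (xs @ [True]) + F (xs @ [False]))"
proof -
  have "sum F (live P (Suc n)) + sum F (stopped P (Suc n)) = sum F (live P (Suc n) \<union> stopped P (Suc n))"
    by (simp add: sum.union_disjoint live_stopped_disjoint)
  also have "\<dots> = (\<Sum>(xs, b)\<in>live P n \<times> UNIV. F (xs @ [b]))"
    unfolding live_stopped_Suc by (subst sum.reindex) (auto intro!: inj_onI sum.cong)
  also have "\<dots> = (\<Sum>xs\<in>live P n. F (xs @ [True]) + F (xs @ [False]))"
    by (simp add: sum.cartesian_product[symmetric] UNIV_bool add.commute)
  finally show ?thesis .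
qed

text \<open>Each further toss redistributes the total of \<open>F\<close> over the live prefixes
  among their extensions and adds the total of \<open>K\<close>. Since \<open>F\<close> carries the
  prefix probabilities inside it, the assumption is the unnormalised form of a Doob decomposition;
  \<open>K = 0\<close> is the martingale case.\<close>

lemma optional_stopping:
  fixes F K :: "bool list \<Rightarrow> real"
  assumes "\<And>xs. F (xs @ [True]) + F (xs @ [False]) = F xs + K xs"
  shows "sum F (live P n) + (\<Sum>m\<le>n. sum F (stopped P m)) = F [] + (\<Sum>m<n. sum K (live P m))"
proof (induction n)
  case 0
  have "sum F (live P 0) + sum F (stopped P 0) = sum F (live P 0 \<union> stopped P 0)"
    by (simp add: sum.union_disjoint live_stopped_disjoint)
  then show ?case by (simp add: live_stopped_0)
next
  case (Suc n)
  then show ?case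
    using sum_live_stopped_Suc[of F P n] by (simp add: assms sum.distrib)
qed

section \<open>From the stream measure to sums over prefixes\<close>

lemma space_coin_tosses [simp]: "space (coin_tosses p) = UNIV"
  by (simp add: coin_tosses_def space_stream_space)

lemma prob_space_coin_tosses: "prob_space (coin_tosses p)"
  unfolding coin_tosses_def by (rule prob_space.prob_space_stream_space[OF prob_space_measure_pmf])

lemma measurable_stake_coin_tosses [measurable]:
  "stake n \<in> coin_tosses p \<rightarrow>\<^sub>M count_space UNIV"
  unfolding coin_tosses_def
  by (subst measurable_cong_sets[OF sets_stream_space_cong[OF sets_measure_pmf_count_space] refl])
     (rule measurable_stake)

lemma sum_lists_Suc:
  fixes f :: "bool list \<Rightarrow> ennreal"
  shows "(\<Sum>xs | length xs = Suc n. f xs) =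
    (\<Sum>xs | length xs = n. f (True # xs)) + (\<Sum>xs | length xs = n. f (False # xs))"
proof -
  have "{xs. length xs = Suc n} = Cons True ` {xs. length xs = n} \<union> Cons False ` {xs. length xs = n}"
    by (auto simp: length_Suc_conv)
  then have "(\<Sum>xs | length xs = Suc n. f xs) =
      sum f (Cons True ` {xs. length xs = n}) + sum f (Cons False ` {xs. length xs = n})"
    by (simp add: finite_lists_of_length) (subst sum.union_disjoint, auto simp: finite_lists_of_length)
  then show ?thesis by (simp add: sum.reindex)
qed

text \<open>Induction on \<open>n\<close>, splitting off the first toss by the product structure of
  the stream space. The function \<open>f\<close> stays arbitrary because the induction hypothesis
  is applied to \<open>f\<close> with the first toss fixed.\<close>

lemma nn_integral_stake:
  fixes f :: "bool list \<Rightarrow> ennreal"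
  assumes p: "0 \<le> p" "p \<le> 1"
  shows "(\<integral>\<^sup>+ \<omega>. f (stake n \<omega>) \<partial>coin_tosses p) =
    (\<Sum>xs | length xs = n. ennreal (prefix_prob p xs) * f xs)"
proof (induction n arbitrary: f)
  case 0
  interpret prob_space "coin_tosses p" by (rule prob_space_coin_tosses)
  show ?case using emeasure_space_1 by (simp add: prefix_prob_def)
next
  case (Suc n)
  have meas: "(\<lambda>\<omega>. f (stake (Suc n) \<omega>)) \<in> borel_measurable (coin_tosses p)"
    by measurable
  have cons: "ennreal (prefix_prob p (b # xs)) = ennreal (if b then p else 1 - p) * ennreal (prefix_prob p xs)"
    for b xs
    using p by (simp add: prefix_prob_def ennreal_mult'[symmetric] mult_ac)
  have "(\<integral>\<^sup>+ \<omega>. f (stake (Suc n) \<omega>) \<partial>coin_tosses p) =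
      (\<integral>\<^sup>+ b. (\<integral>\<^sup>+ \<omega>. f (b # stake n \<omega>) \<partial>coin_tosses p) \<partial>measure_pmf (bernoulli_pmf p))"
    unfolding coin_tosses_def
    by (subst prob_space.nn_integral_stream_space[OF prob_space_measure_pmf])
       (use meas in \<open>simp_all add: coin_tosses_def[symmetric]\<close>)
  also have "\<dots> = (\<Sum>xs | length xs = Suc n. ennreal (prefix_prob p xs) * f xs)"
    using p Suc[of "\<lambda>xs. f (True # xs)"] Suc[of "\<lambda>xs. f (False # xs)"]
    by (simp add: sum_lists_Suc cons sum_distrib_left sum_distrib_right mult_ac)
  finally show ?case .
qed

lemma emeasure_stake:
  assumes p: "0 \<le> p" "p \<le> 1" and A: "A \<subseteq> {xs. length xs = n}"
  shows "emeasure (coin_tosses p) {\<omega>. stake n \<omega> \<in> A} = ennreal (sum (prefix_prob p) A)"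
proof -
  have fin: "finite A" using A finite_lists_of_length finite_subset by blast
  have [measurable]: "{\<omega>. stake n \<omega> \<in> A} \<in> sets (coin_tosses p)"
    using measurable_sets[OF measurable_stake_coin_tosses[of n p], of A] by (simp add: vimage_def)
  have "emeasure (coin_tosses p) {\<omega>. stake n \<omega> \<in> A} =
      (\<integral>\<^sup>+ \<omega>. indicator {\<omega>. stake n \<omega> \<in> A} \<omega> \<partial>coin_tosses p)"
    by (rule nn_integral_indicator[symmetric]) measurable
  also have "\<dots> = (\<integral>\<^sup>+ \<omega>. indicator A (stake n \<omega>) \<partial>coin_tosses p)"
    by (simp add: indicator_def)
  also have "\<dots> = (\<Sum>xs | length xs = n. ennreal (prefix_prob p xs) * indicator A xs)"
    by (rule nn_integral_stake[OF p])
  also have "\<dots> = (\<Sum>xs\<in>A. ennreal (prefix_prob p xs))"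
    using A by (intro sum.mono_neutral_cong_right) (auto simp: finite_lists_of_length indicator_def)
  also have "\<dots> = ennreal (sum (prefix_prob p) A)"
    using p by (intro sum_ennreal) (auto simp: prefix_prob_def)
  finally show ?thesis .
qed

lemma prefix_prob_nonneg: "0 \<le> p \<Longrightarrow> p \<le> 1 \<Longrightarrow> 0 \<le> prefix_prob p xs"
  by (simp add: prefix_prob_def)

lemma measure_stake:
  assumes p: "0 \<le> p" "p \<le> 1" and A: "A \<subseteq> {xs. length xs = n}"
  shows "measure (coin_tosses p) {\<omega>. stake n \<omega> \<in> A} = sum (prefix_prob p) A"
  using emeasure_stake[OF assms] prefix_prob_nonneg[OF p]
  by (simp add: measure_def sum_nonneg)

lemma color_at_eq_prefix_color: "color_at P n \<omega> = prefix_color P (stake n \<omega>)"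
  by (simp add: color_at_def prefix_color_def heads_def tails_def)

lemma stops_at_iff_stopped: "stops_at P n \<omega> \<longleftrightarrow> stake n \<omega> \<in> stopped P n"
  by (auto simp: stops_at_def stopped_def color_at_eq_prefix_color take_stake min_def)

lemma less_num_tosses_iff_live: "enat n < num_tosses P \<omega> \<longleftrightarrow> stake n \<omega> \<in> live P n"
proof -
  have "enat n < num_tosses P \<omega> \<longleftrightarrow> (\<forall>m\<le>n. color_at P m \<omega> = White)"
  proof (cases "num_tosses P \<omega>")
    case (enat k)
    then have "stops_at P k \<omega>" by (simp add: num_tosses_eq_enat_iff)
    then show ?thesis unfolding enat stops_at_def
      by (auto simp: not_less) (meson not_less)
  next
    case infinity
    have "color_at P m \<omega> = White" for m
    proof (rule ccontr)
      assume "color_at P m \<omega> \<noteq> White"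
      then have "num_tosses P \<omega> \<le> enat m"
        unfolding num_tosses_def by (intro INF_lower) auto
      with infinity show False by simp
    qed
    then show ?thesis by (simp add: infinity)
  qed
  then show ?thesis
    by (auto simp: live_def color_at_eq_prefix_color take_stake min_def)
qed

text \<open>The tail-sum formula: the expectation of a variable with values in the extended naturals
  is the sum over \<open>n\<close> of the probability that it exceeds \<open>n\<close>.\<close>

lemma expected_tosses_eq_suminf:
  assumes "0 \<le> p" "p \<le> 1"
  shows "expected_tosses p P = (\<Sum>n. ennreal (sum (prefix_prob p) (live P n)))"
proof -
  have "emeasure (coin_tosses p) {\<omega>. stake n \<omega> \<in> live P n} = ennreal (sum (prefix_prob p) (live P n))" for n
    by (rule emeasure_stake[OF assms]) (auto simp: live_def)
  then show ?thesis
    unfolding expected_tosses_def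
    by (subst nn_integral_enat_function) (auto simp: less_num_tosses_iff_live)
qed

lemma expected_tosses_finite_iff:
  assumes "0 \<le> p" "p \<le> 1"
  shows "expected_tosses p P < \<infinity> \<longleftrightarrow> summable (\<lambda>n. sum (prefix_prob p) (live P n))"
proof -
  have nn: "0 \<le> sum (prefix_prob p) (live P n)" for n
    by (simp add: sum_nonneg prefix_prob_nonneg assms)
  show ?thesis
    unfolding expected_tosses_eq_suminf[OF assms] using nn
    by (auto simp: less_top[symmetric] intro: summable_suminf_not_top dest: ennreal_suminf_neq_top)
qed

lemma expected_tosses_sums:
  assumes "0 \<le> p" "p \<le> 1" "expected_tosses p P < \<infinity>"
  shows "(\<lambda>n. sum (prefix_prob p) (live P n)) sums enn2real (expected_tosses p P)"
proof -
  have s: "summable (\<lambda>n. sum (prefix_prob p) (live P n))"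
    using expected_tosses_finite_iff assms by blast
  have nn: "0 \<le> sum (prefix_prob p) (live P n)" for n
    by (simp add: sum_nonneg prefix_prob_nonneg assms)
  have "expected_tosses p P = ennreal (\<Sum>n. sum (prefix_prob p) (live P n))"
    unfolding expected_tosses_eq_suminf[OF assms(1,2)]
    using s nn by (intro suminf_ennreal_eq) (auto simp: summable_sums)
  then show ?thesis using s nn by (simp add: suminf_nonneg summable_sums)
qed

text \<open>A policy stops at no more than one time, so the events of stopping at time
  \<open>n\<close> with color \<open>C\<close> are disjoint and countable additivity
  applies.\<close>

lemma stopping_color_sums:
  assumes p: "0 \<le> p" "p \<le> 1" and "C \<noteq> White"
  shows "(\<lambda>n. sum (prefix_prob p) {xs \<in> stopped P n. prefix_color P xs = C}) sums
    measure (coin_tosses p) {\<omega>. \<exists>n. stops_at P n \<omega> \<and> color_at P n \<omega> = C}"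
proof -
  interpret prob_space "coin_tosses p" by (rule prob_space_coin_tosses)
  define A where "A n = {\<omega>. stops_at P n \<omega> \<and> color_at P n \<omega> = C}" for n
  have A_eq: "A n = {\<omega>. stake n \<omega> \<in> {xs \<in> stopped P n. prefix_color P xs = C}}" for n
    by (simp add: A_def stops_at_iff_stopped color_at_eq_prefix_color)
  have [measurable]: "A n \<in> sets (coin_tosses p)" for n
    using measurable_sets[OF measurable_stake_coin_tosses[of n p],
        of "{xs \<in> stopped P n. prefix_color P xs = C}"]
    by (simp add: vimage_def A_eq)
  have "m = n" if "stops_at P m \<omega>" "stops_at P n \<omega>" for m n \<omega>
    using that unfolding stops_at_def by (metis linorder_neqE_nat)
  then have "disjoint_family A"
    by (auto simp: disjoint_family_on_def A_def)
  then have "(\<lambda>n. measure (coin_tosses p) (A n)) sums measure (coin_tosses p) (\<Union>n. A n)"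
    by (intro finite_measure_UNION) auto
  moreover have "measure (coin_tosses p) (A n) =
      sum (prefix_prob p) {xs \<in> stopped P n. prefix_color P xs = C}" for n
    unfolding A_eq by (rule measure_stake[OF p]) (auto simp: stopped_def)
  moreover have "(\<Union>n. A n) = {\<omega>. \<exists>n. stops_at P n \<omega> \<and> color_at P n \<omega> = C}"
    by (auto simp: A_def)
  ultimately show ?thesis by simp
qed

section \<open>The mixture weight, the Wald term and the cost of a threshold\<close>

context
  fixes \<epsilon> \<beta> :: real
  assumes eps: "0 < \<epsilon>" "\<epsilon> < 1/2" and beta: "0 < \<beta>"
begin

text \<open>The unnormalised equal mixture of the two hypotheses, hence of total mass
  \<open>2\<close>.\<close>

definition weight :: "bool list \<Rightarrow> real" where
  "weight xs = prefix_prob (1/2 + \<epsilon>) xs + prefix_prob (1/2 - \<epsilon>) xs"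

text \<open>The factor \<open>\<beta> / (2 * \<epsilon>)\<close> is the cost of a toss divided by
  the drift of \<open>h - t\<close> per toss.\<close>

definition wald :: "bool list \<Rightarrow> real" where
  "wald xs = \<beta> / (2 * \<epsilon>) * (real (count_list xs True) - real (count_list xs False)) *
     (prefix_prob (1/2 + \<epsilon>) xs - prefix_prob (1/2 - \<epsilon>) xs)"

text \<open>The second branch is meant for blue cells. White cells fall into it too, but the sums
  range over stopping prefixes only.\<close>

definition error_weight :: "policy \<Rightarrow> bool list \<Rightarrow> real" where
  "error_weight P xs =
     (if prefix_color P xs = Red then prefix_prob (1/2 + \<epsilon>) xs else prefix_prob (1/2 - \<epsilon>) xs)"

definition objective :: "policy \<Rightarrow> real" where
  "objective P = (delta_plus \<epsilon> P + delta_minus \<epsilon> P) + \<beta> * (H_plus \<epsilon> P + H_minus \<epsilon> P)"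

text \<open>The cost per unit of \<open>weight\<close> of stopping at
  \<open>\<bar>h - t\<bar> = c\<close> with the likelier prediction, once the toss costs have been
  moved to the stopping prefixes.\<close>

definition threshold_cost :: "nat \<Rightarrow> real" where
  "threshold_cost c =
     ((1/2 - \<epsilon>) ^ c + \<beta> / (2 * \<epsilon>) * real c * ((1/2 + \<epsilon>) ^ c - (1/2 - \<epsilon>) ^ c)) /
     ((1/2 + \<epsilon>) ^ c + (1/2 - \<epsilon>) ^ c)"

lemma weight_Nil: "weight [] = 2" and wald_Nil: "wald [] = 0"
  by (simp_all add: weight_def wald_def prefix_prob_def)

lemma weight_nonneg: "0 \<le> weight xs"
  using eps by (simp add: weight_def prefix_prob_nonneg)

lemma weight_step: "weight (xs @ [True]) + weight (xs @ [False]) = weight xs + 0"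
  by (simp add: weight_def prefix_prob_def algebra_simps)

text \<open>The drift of \<open>h - t\<close> is \<open>2 * \<epsilon>\<close> under one hypothesis
  and \<open>- 2 * \<epsilon>\<close> under the other. As \<open>wald\<close> takes the difference
  of the two probabilities, the drifts add up to a multiple of \<open>weight\<close>.\<close>

lemma wald_step: "wald (xs @ [True]) + wald (xs @ [False]) = wald xs + \<beta> * weight xs"
proof -
  define a b where "a = prefix_prob (1/2 + \<epsilon>) xs" and "b = prefix_prob (1/2 - \<epsilon>) xs"
  define d where "d = real (count_list xs True) - real (count_list xs False)"
  define k where "k = \<beta> / (2 * \<epsilon>)"
  have T: "wald (xs @ [True]) = k * (d + 1) * ((1/2 + \<epsilon>) * a - (1/2 - \<epsilon>) * b)"
    by (simp add: wald_def prefix_prob_def a_def b_def d_def k_def mult_ac add_ac diff_diff_eq)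
  have F: "wald (xs @ [False]) = k * (d - 1) * ((1/2 - \<epsilon>) * a - (1/2 + \<epsilon>) * b)"
    by (simp add: wald_def prefix_prob_def a_def b_def d_def k_def mult_ac add_ac diff_diff_eq)
  have "wald (xs @ [True]) + wald (xs @ [False]) =
      k * d * (a - b) + (k * (2 * \<epsilon>)) * (a + b)"
    unfolding T F by (simp add: field_simps)
  also have "k * (2 * \<epsilon>) = \<beta>"
    using eps by (simp add: k_def)
  finally show ?thesis by (simp add: wald_def weight_def a_def b_def d_def k_def)
qed

text \<open>The identity is symmetric under exchanging \<open>h\<close> and \<open>t\<close>, and for \<open>h = t + c\<close> the common
  factor \<open>(1/4 - \<epsilon>\<^sup>2) ^ t\<close> cancels.\<close>

lemma min_prefix_prob_plus_wald:
  "min (prefix_prob (1/2 + \<epsilon>) xs) (prefix_prob (1/2 - \<epsilon>) xs) + wald xs =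
   threshold_cost (nat \<bar>int (count_list xs True) - int (count_list xs False)\<bar>) * weight xs"
proof -
  let ?p = "1/2 + \<epsilon>" and ?q = "1/2 - \<epsilon>"
  have *: "min (?p ^ h * ?q ^ t) (?q ^ h * ?p ^ t) +
      \<beta> / (2 * \<epsilon>) * (real h - real t) * (?p ^ h * ?q ^ t - ?q ^ h * ?p ^ t) =
      threshold_cost (h - t) * (?p ^ h * ?q ^ t + ?q ^ h * ?p ^ t)" if "t \<le> h" for h t
  proof -
    from that obtain c where h: "h = t + c" using le_Suc_ex by blast
    have pos: "0 < ?p ^ c + ?q ^ c" using eps by (intro add_pos_pos) auto
    have le: "?q ^ c \<le> ?p ^ c" using eps by (intro power_mono) auto
    define r where "r = (?p * ?q) ^ t"
    have "0 \<le> r" using eps by (simp add: r_def)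
    have e: "?p ^ h * ?q ^ t = r * ?p ^ c" "?q ^ h * ?p ^ t = r * ?q ^ c"
      by (simp_all add: h r_def power_add power_mult_distrib)
    have m: "min (r * ?p ^ c) (r * ?q ^ c) = r * ?q ^ c"
      using le \<open>0 \<le> r\<close> by (simp add: min_def mult_left_mono antisym)
    have "threshold_cost c * (r * ?p ^ c + r * ?q ^ c) = r * (threshold_cost c * (?p ^ c + ?q ^ c))"
      by (simp add: algebra_simps)
    also have "threshold_cost c * (?p ^ c + ?q ^ c) =
        ?q ^ c + \<beta> / (2 * \<epsilon>) * real c * (?p ^ c - ?q ^ c)"
      using pos by (simp add: threshold_cost_def)
    finally show ?thesis
      unfolding e m by (simp add: h algebra_simps)
  qed
  let ?h = "count_list xs True" and ?t = "count_list xs False"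
  show ?thesis
  proof (cases "?t \<le> ?h")
    case True
    then show ?thesis using *[of ?t ?h]
      by (simp add: wald_def weight_def prefix_prob_def nat_diff_distrib)
  next
    case False
    then have "nat \<bar>int ?h - int ?t\<bar> = ?t - ?h" by simp
    with False show ?thesis using *[of ?h ?t]
      by (simp add: wald_def weight_def prefix_prob_def min.commute algebra_simps)
  qed
qed

text \<open>The hypothesis \<open>1/2 + \<epsilon>\<close> gives the prefix at least as much
  probability as the other one when heads are in the majority, and at most as much when tails are.
  So the two differences in \<open>wald\<close> never have opposite signs.\<close>

lemma wald_nonneg: "0 \<le> wald xs"
  and wald_le: "wald xs \<le> \<beta> / (2 * \<epsilon>) *
    \<bar>real (count_list xs True) - real (count_list xs False)\<bar> * weight xs"
proof -
  let ?p = "1/2 + \<epsilon>" and ?q = "1/2 - \<epsilon>"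
  let ?h = "count_list xs True" and ?t = "count_list xs False"
  let ?d = "real ?h - real ?t" and ?a = "prefix_prob ?p xs" and ?b = "prefix_prob ?q xs"
  have *: "?q ^ m * ?p ^ n \<le> ?p ^ m * ?q ^ n" if nm: "n \<le> m" for m n :: nat
  proof -
    from nm obtain c where m: "m = n + c" using le_Suc_ex by blast
    have "?q ^ c \<le> ?p ^ c" using eps by (intro power_mono) auto
    then have "(?p * ?q) ^ n * ?q ^ c \<le> (?p * ?q) ^ n * ?p ^ c"
      using eps by (intro mult_left_mono) auto
    then show ?thesis by (simp add: m power_add power_mult_distrib mult_ac)
  qed
  have "0 \<le> ?d * (?a - ?b)"
  proof (cases "?t \<le> ?h")
    case True
    then show ?thesis using *[of ?t ?h] by (intro mult_nonneg_nonneg) (auto simp: prefix_prob_def)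
  next
    case False
    then show ?thesis using *[of ?h ?t]
      by (intro mult_nonpos_nonpos) (auto simp: prefix_prob_def mult_ac)
  qed
  then show "0 \<le> wald xs"
    using eps beta by (simp add: wald_def mult.assoc)
  have "?d * (?a - ?b) \<le> \<bar>?d\<bar> * \<bar>?a - ?b\<bar>" by (metis abs_ge_self abs_mult)
  also have "\<dots> \<le> \<bar>?d\<bar> * weight xs"
    using eps prefix_prob_nonneg[of ?p xs] prefix_prob_nonneg[of ?q xs]
    by (intro mult_left_mono) (auto simp: weight_def)
  finally show "wald xs \<le> \<beta> / (2 * \<epsilon>) * \<bar>?d\<bar> * weight xs"
    unfolding wald_def mult.assoc using eps beta by (intro mult_left_mono) auto
qed

text \<open>Linear growth of the cost confines the search for a minimum to finitely many
  thresholds.\<close>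

lemma threshold_cost_ge:
  assumes "0 < c"
  shows "\<beta> * real c \<le> threshold_cost c"
proof -
  let ?p = "1/2 + \<epsilon>" and ?q = "1/2 - \<epsilon>"
  obtain k where c: "c = Suc k" using assms by (cases c) auto
  have "?q ^ k \<le> ?p ^ k" using eps by (intro power_mono) auto
  then have "(?p * ?q) * ?q ^ k \<le> (?p * ?q) * ?p ^ k"
    using eps by (intro mult_left_mono) auto
  \<comment> \<open>Since \<open>?p + ?q = 1\<close> and \<open>?p - ?q = 2 * \<epsilon>\<close>,
    the right side minus the left side is \<open>2 * ?p * ?q * (?p ^ k - ?q ^ k)\<close>.\<close>
  then have "2 * \<epsilon> * (?p ^ c + ?q ^ c) \<le> ?p ^ c - ?q ^ c"
    by (simp add: c algebra_simps)
  then have "\<beta> / (2 * \<epsilon>) * real c * (2 * \<epsilon> * (?p ^ c + ?q ^ c)) \<le>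
      \<beta> / (2 * \<epsilon>) * real c * (?p ^ c - ?q ^ c)"
    using eps beta by (intro mult_left_mono) auto
  then have "\<beta> * real c * (?p ^ c + ?q ^ c) \<le> \<beta> / (2 * \<epsilon>) * real c * (?p ^ c - ?q ^ c)"
    using eps by simp
  moreover have "0 \<le> ?q ^ c" "0 < ?p ^ c + ?q ^ c"
    using eps by (auto intro!: add_pos_pos)
  ultimately show ?thesis
    unfolding threshold_cost_def by (subst pos_le_divide_eq) auto
qed

lemma threshold_cost_minimum: "\<exists>c. \<forall>k. threshold_cost c \<le> threshold_cost k"
proof -
  \<comment> \<open>Beyond \<open>N\<close> the linear lower bound already exceeds the cost of
    threshold \<open>0\<close>.\<close>
  obtain N where N: "threshold_cost 0 / \<beta> < real N" using reals_Archimedean2 by blast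
  define S where "S = threshold_cost ` {..N}"
  have "Min S \<in> S" unfolding S_def by (intro Min_in) auto
  then obtain c where c: "Min S = threshold_cost c" by (metis S_def imageE)
  have le: "threshold_cost c \<le> threshold_cost k" if "k \<le> N" for k
    unfolding c[symmetric] using that by (intro Min_le) (auto simp: S_def)
  have "threshold_cost c \<le> threshold_cost k" for k
  proof (cases "k \<le> N")
    case False
    have "threshold_cost c \<le> threshold_cost 0" by (rule le) simp
    also have "\<dots> \<le> \<beta> * real k"
    proof -
      have "threshold_cost 0 / \<beta> \<le> real k" using N False by linarith
      then show ?thesis using beta by (simp add: field_simps)
    qed
    also have "\<dots> \<le> threshold_cost k" using False by (intro threshold_cost_ge) auto
    finally show ?thesis .
  qed (rule le)
  then show ?thesis by blast
qed

section \<open>Passing to the limit and the lower bound for all policies\<close>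

lemma admissible_iff:
  "admissible \<epsilon> P \<longleftrightarrow> summable (\<lambda>n. sum weight (live P n))"
proof -
  have nn: "0 \<le> sum (prefix_prob p) (live P n)" if "p \<in> {1/2 + \<epsilon>, 1/2 - \<epsilon>}" for p n
    using eps that by (auto intro!: sum_nonneg prefix_prob_nonneg)
  have eq: "(\<lambda>n. sum weight (live P n)) =
      (\<lambda>n. sum (prefix_prob (1/2 + \<epsilon>)) (live P n) + sum (prefix_prob (1/2 - \<epsilon>)) (live P n))"
    by (simp add: weight_def sum.distrib fun_eq_iff)
  have fin: "expected_tosses p P < \<infinity> \<longleftrightarrow> summable (\<lambda>n. sum (prefix_prob p) (live P n))"
    if "p \<in> {1/2 + \<epsilon>, 1/2 - \<epsilon>}" for p
    using eps that by (intro expected_tosses_finite_iff) auto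
  have dom: "summable (\<lambda>n. sum (prefix_prob p) (live P n))"
    if "summable (\<lambda>n. sum weight (live P n))" "p \<in> {1/2 + \<epsilon>, 1/2 - \<epsilon>}" for p
    using that(1) unfolding eq
    by (rule summable_comparison_test'[where N = 0]) (use that(2) nn in auto)
  show ?thesis
    unfolding admissible_def fin[OF insertI1] fin[OF insertI2[OF singletonI]]
    using dom[of "1/2 + \<epsilon>"] dom[of "1/2 - \<epsilon>"] unfolding eq by (auto intro: summable_add)
qed

lemma error_weight_sums:
  "(\<lambda>n. sum (error_weight P) (stopped P n)) sums (delta_plus \<epsilon> P + delta_minus \<epsilon> P)"
proof -
  have "sum (error_weight P) (stopped P n) =
     sum (prefix_prob (1/2 + \<epsilon>)) {xs \<in> stopped P n. prefix_color P xs = Red} +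
     sum (prefix_prob (1/2 - \<epsilon>)) {xs \<in> stopped P n. prefix_color P xs = Blue}" (is "?L = ?R") for n
  proof -
    have "?L = sum (error_weight P) ({xs \<in> stopped P n. prefix_color P xs = Red} \<union>
        {xs \<in> stopped P n. prefix_color P xs = Blue})"
      by (rule sum.cong) (auto simp: stopped_def intro: color.exhaust)
    also have "\<dots> = ?R"
      by (subst sum.union_disjoint) (auto simp: error_weight_def intro!: arg_cong2[where f = "(+)"] sum.cong)
    finally show ?thesis .
  qed
  moreover have "delta_plus \<epsilon> P =
      measure (coin_tosses (1/2 + \<epsilon>)) {\<omega>. \<exists>n. stops_at P n \<omega> \<and> color_at P n \<omega> = Red}"
    "delta_minus \<epsilon> P =
      measure (coin_tosses (1/2 - \<epsilon>)) {\<omega>. \<exists>n. stops_at P n \<omega> \<and> color_at P n \<omega> = Blue}"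
    by (simp_all add: delta_plus_def delta_minus_def predicts_minus_def predicts_plus_def)
  ultimately show ?thesis
    using eps by (auto intro!: sums_add stopping_color_sums)
qed

lemma truncated_objective_tendsto:
  assumes "admissible \<epsilon> P"
  shows "(\<lambda>n. (\<Sum>m\<le>n. sum (error_weight P) (stopped P m)) + \<beta> * (\<Sum>m<n. sum weight (live P m)))
    \<longlonglongrightarrow> objective P"
proof -
  have "(\<lambda>n. sum weight (live P n)) sums (H_plus \<epsilon> P + H_minus \<epsilon> P)"
    using assms eps unfolding weight_def sum.distrib H_plus_def H_minus_def admissible_def
    by (intro sums_add expected_tosses_sums) auto
  \<comment> \<open>Errors are summed up to \<open>n\<close> inclusive and tosses only below
    \<open>n\<close>, the ranges of \<open>optional_stopping\<close>; hence the two forms of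
    convergence of partial sums.\<close>
  from this[unfolded sums_def] error_weight_sums[of P, unfolded sums_def_le]
  show ?thesis
    unfolding objective_def by (intro tendsto_intros)
qed

text \<open>Optional stopping for \<open>wald\<close> trades the cost of the tosses made so far for
  \<open>wald\<close> at the stopping prefixes, plus a boundary term at the prefixes still
  live.\<close>

lemma truncated_objective_eq:
  "(\<Sum>m\<le>n. sum (error_weight P) (stopped P m)) + \<beta> * (\<Sum>m<n. sum weight (live P m)) =
   (\<Sum>m\<le>n. \<Sum>xs\<in>stopped P m. error_weight P xs + wald xs) + sum wald (live P n)"
  using optional_stopping[of wald "\<lambda>xs. \<beta> * weight xs" P n, OF wald_step]
  by (simp add: wald_Nil sum.distrib sum_distrib_left)

lemma weight_stopped_live:
  "(\<Sum>m\<le>n. sum weight (stopped P m)) = 2 - sum weight (live P n)"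
  using optional_stopping[of weight "\<lambda>_. 0" P n, OF weight_step] by (simp add: weight_Nil)

lemma objective_ge:
  assumes adm: "admissible \<epsilon> P" and A: "\<And>k. A \<le> threshold_cost k"
  shows "2 * A \<le> objective P"
proof (rule LIMSEQ_le)
  show "(\<lambda>n. A * (2 - sum weight (live P n))) \<longlonglongrightarrow> 2 * A"
    using summable_LIMSEQ_zero[OF adm[unfolded admissible_iff]]
    by (auto intro!: tendsto_eq_intros)
  show "(\<lambda>n. (\<Sum>m\<le>n. sum (error_weight P) (stopped P m)) + \<beta> * (\<Sum>m<n. sum weight (live P m)))
      \<longlonglongrightarrow> objective P"
    by (rule truncated_objective_tendsto[OF adm])
  have pt: "A * weight xs \<le> error_weight P xs + wald xs" for xs
  proof -
    \<comment> \<open>Whatever is predicted, the error costs at least the smaller of the two prefix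
      probabilities.\<close>
    have "A * weight xs \<le> min (prefix_prob (1/2 + \<epsilon>) xs) (prefix_prob (1/2 - \<epsilon>) xs) + wald xs"
      unfolding min_prefix_prob_plus_wald by (intro mult_right_mono A weight_nonneg)
    then show ?thesis by (auto simp: error_weight_def split: if_splits)
  qed
  have "A * (2 - sum weight (live P n)) \<le>
      (\<Sum>m\<le>n. sum (error_weight P) (stopped P m)) + \<beta> * (\<Sum>m<n. sum weight (live P m))" for n
  proof -
    have "A * (2 - sum weight (live P n)) = (\<Sum>m\<le>n. \<Sum>xs\<in>stopped P m. A * weight xs)"
      by (simp add: weight_stopped_live[symmetric] sum_distrib_left)
    also have "\<dots> \<le> (\<Sum>m\<le>n. \<Sum>xs\<in>stopped P m. error_weight P xs + wald xs)"
      by (intro sum_mono pt)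
    also have "\<dots> \<le> \<dots> + sum wald (live P n)"
      by (simp add: sum_nonneg wald_nonneg)
    finally show ?thesis unfolding truncated_objective_eq .
  qed
  then show "\<exists>N. \<forall>n\<ge>N. A * (2 - sum weight (live P n)) \<le>
      (\<Sum>m\<le>n. sum (error_weight P) (stopped P m)) + \<beta> * (\<Sum>m<n. sum weight (live P m))"
    by blast
qed

section \<open>Linear policies attain the bound\<close>

text \<open>The difference moves in unit steps and cannot jump over the two barriers. For
  \<open>c = 0\<close> no prefix is live, so the strict bound holds vacuously.\<close>

lemma linear_policy_live_bound:
  assumes "xs \<in> live (linear_policy c) n"
  shows "\<bar>int (count_list xs True) - int (count_list xs False)\<bar> < int c"
  using assms
proof (induction n arbitrary: xs)
  case 0
  then show ?case by (auto simp: live_def prefix_color_def linear_policy_def split: if_splits)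
next
  case (Suc n)
  then have "xs \<in> (\<lambda>(ys, b). ys @ [b]) ` (live (linear_policy c) n \<times> UNIV)"
    by (simp flip: live_stopped_Suc)
  then obtain ys b where xs: "xs = ys @ [b]" and ys: "ys \<in> live (linear_policy c) n"
    by auto
  have "prefix_color (linear_policy c) xs = White"
    using Suc.prems by (force simp: live_def)
  then have "\<bar>int (count_list xs True) - int (count_list xs False)\<bar> \<noteq> int c"
    by (auto simp: prefix_color_def linear_policy_def split: if_splits)
  with Suc.IH[OF ys] show ?case by (auto simp: xs split: if_splits)
qed

lemma wald_live_linear_policy:
  "sum wald (live (linear_policy c) n) \<le> \<beta> / (2 * \<epsilon>) * real c * sum weight (live (linear_policy c) n)"
  unfolding sum_distrib_left
proof (rule sum_mono)
  fix xs assume "xs \<in> live (linear_policy c) n"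
  then have "\<bar>int (count_list xs True) - int (count_list xs False)\<bar> < int c"
    by (rule linear_policy_live_bound)
  then have "\<bar>real (count_list xs True) - real (count_list xs False)\<bar> \<le> real c" by linarith
  then have "\<beta> / (2 * \<epsilon>) * \<bar>real (count_list xs True) - real (count_list xs False)\<bar> * weight xs \<le>
      \<beta> / (2 * \<epsilon>) * real c * weight xs"
    using eps beta weight_nonneg by (intro mult_right_mono mult_left_mono) auto
  with wald_le[of xs] show "wald xs \<le> \<beta> / (2 * \<epsilon>) * real c * weight xs" by linarith
qed

text \<open>The sign of \<open>h - t\<close> selects the likelier hypothesis, so the error is the
  smaller probability. In a tie both probabilities agree and either prediction attains the
  minimum.\<close>

lemma linear_policy_stopped:
  assumes "xs \<in> stopped (linear_policy c) n"
  shows "error_weight (linear_policy c) xs + wald xs = threshold_cost c * weight xs"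
proof -
  let ?h = "count_list xs True" and ?t = "count_list xs False"
  let ?a = "prefix_prob (1/2 + \<epsilon>) xs" and ?b = "prefix_prob (1/2 - \<epsilon>) xs"
  have c: "nat \<bar>int ?h - int ?t\<bar> = c"
    and col: "prefix_color (linear_policy c) xs = (if ?h > ?t then Blue else Red)"
    using assms by (auto simp: stopped_def prefix_color_def linear_policy_def split: if_splits)
  have "0 < \<beta> / (2 * \<epsilon>)" using eps beta by simp
  moreover have "0 \<le> \<beta> / (2 * \<epsilon>) * ((real ?h - real ?t) * (?a - ?b))"
    using wald_nonneg[of xs] by (simp only: wald_def mult.assoc)
  ultimately have sgn: "0 \<le> (real ?h - real ?t) * (?a - ?b)"
    by (meson mult_pos_neg not_less)
  have "error_weight (linear_policy c) xs = min ?a ?b"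
  proof (cases "?h = ?t")
    case True
    then show ?thesis by (simp add: error_weight_def col prefix_prob_def mult_ac)
  next
    case False
    then show ?thesis using sgn
      by (auto simp: error_weight_def col zero_le_mult_iff min_def)
  qed
  then show ?thesis using min_prefix_prob_plus_wald[of xs] by (simp add: c)
qed

text \<open>The truncated Wald identity needs no finiteness in advance: it bounds the expected
  number of tosses up to \<open>n\<close> by \<open>wald\<close> at live and stopped prefixes, each
  at most a constant times a total weight of at most \<open>2\<close>.\<close>

lemma admissible_linear_policy: "admissible \<epsilon> (linear_policy c)"
proof -
  let ?P = "linear_policy c" and ?K = "\<beta> / (2 * \<epsilon>) * real c"
  have K: "0 \<le> ?K" using eps beta by simp
  have stopped_le: "sum wald (stopped ?P m) \<le> threshold_cost c * sum weight (stopped ?P m)" for m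
    unfolding sum_distrib_left
  proof (rule sum_mono)
    fix xs assume "xs \<in> stopped ?P m"
    moreover have "0 \<le> error_weight ?P xs" using eps by (simp add: error_weight_def prefix_prob_nonneg)
    ultimately show "wald xs \<le> threshold_cost c * weight xs"
      using linear_policy_stopped[of xs c m] by linarith
  qed
  have tc: "0 \<le> threshold_cost c"
  proof (cases "c = 0")
    case False
    then have "\<beta> * real c \<le> threshold_cost c" by (intro threshold_cost_ge) simp
    moreover have "0 \<le> \<beta> * real c" using beta by simp
    ultimately show ?thesis by linarith
  qed (simp add: threshold_cost_def)
  have "(\<Sum>m<n. sum weight (live ?P m)) \<le> 2 * (threshold_cost c + ?K) / \<beta>" for n
  proof -
    have s: "0 \<le> sum weight (live ?P n)" by (simp add: sum_nonneg weight_nonneg)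
    have t: "0 \<le> (\<Sum>m\<le>n. sum weight (stopped ?P m))" by (simp add: sum_nonneg weight_nonneg)
    have "\<beta> * (\<Sum>m<n. sum weight (live ?P m)) = sum wald (live ?P n) + (\<Sum>m\<le>n. sum wald (stopped ?P m))"
      using optional_stopping[of wald "\<lambda>xs. \<beta> * weight xs" ?P n, OF wald_step]
      by (simp add: wald_Nil sum_distrib_left)
    also have "\<dots> \<le> ?K * sum weight (live ?P n) + (\<Sum>m\<le>n. threshold_cost c * sum weight (stopped ?P m))"
      by (intro add_mono wald_live_linear_policy sum_mono stopped_le)
    also have "\<dots> = ?K * sum weight (live ?P n) + threshold_cost c * (2 - sum weight (live ?P n))"
      by (simp add: sum_distrib_left[symmetric] weight_stopped_live)
    also have "\<dots> \<le> ?K * 2 + threshold_cost c * 2"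
      using s t K tc by (intro add_mono mult_left_mono) (auto simp: weight_stopped_live)
    finally show ?thesis using beta by (simp add: field_simps)
  qed
  then show ?thesis
    unfolding admissible_iff
    by (intro summableI_nonneg_bounded[where x = "2 * (threshold_cost c + ?K) / \<beta>"])
       (auto simp: sum_nonneg weight_nonneg)
qed

text \<open>Every stopping prefix has the same cost per unit of weight, and the boundary term is
  squeezed between \<open>0\<close> and a multiple of the vanishing live weight.\<close>

lemma objective_linear_policy: "objective (linear_policy c) = 2 * threshold_cost c"
proof -
  let ?P = "linear_policy c" and ?K = "\<beta> / (2 * \<epsilon>) * real c"
  have w0: "(\<lambda>n. sum weight (live ?P n)) \<longlonglongrightarrow> 0"
    using admissible_linear_policy unfolding admissible_iff by (rule summable_LIMSEQ_zero)
  have g0: "(\<lambda>n. sum wald (live ?P n)) \<longlonglongrightarrow> 0"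
  proof (rule real_tendsto_sandwich[where f = "\<lambda>_. 0"])
    show "(\<lambda>n. ?K * sum weight (live ?P n)) \<longlonglongrightarrow> 0" using w0 by (rule tendsto_mult_right_zero)
  qed (auto simp: sum_nonneg wald_nonneg intro!: always_eventually wald_live_linear_policy
      simp del: times_divide_eq_left)
  have "(\<Sum>m\<le>n. sum (error_weight ?P) (stopped ?P m)) + \<beta> * (\<Sum>m<n. sum weight (live ?P m)) =
      threshold_cost c * (2 - sum weight (live ?P n)) + sum wald (live ?P n)" for n
    unfolding truncated_objective_eq
    by (simp add: weight_stopped_live[symmetric] sum_distrib_left linear_policy_stopped)
  moreover have "(\<lambda>n. threshold_cost c * (2 - sum weight (live ?P n)) + sum wald (live ?P n))
      \<longlonglongrightarrow> threshold_cost c * (2 - 0) + 0"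
    by (intro tendsto_intros w0 g0)
  ultimately show ?thesis
    using truncated_objective_tendsto[OF admissible_linear_policy[of c]] LIMSEQ_unique
    by (fastforce simp: mult.commute)
qed

end

theorem theorem2:
  fixes \<epsilon> \<beta> :: real
  assumes "0 < \<epsilon>" and "\<epsilon> < 1/2" and "\<beta> > 0"
  shows "\<exists>c::nat. admissible \<epsilon> (linear_policy c) \<and>
    (\<forall>P::policy. admissible \<epsilon> P \<longrightarrow>
       (delta_plus \<epsilon> (linear_policy c) + delta_minus \<epsilon> (linear_policy c))
         + \<beta> * (H_plus \<epsilon> (linear_policy c) + H_minus \<epsilon> (linear_policy c))
       \<le> (delta_plus \<epsilon> P + delta_minus \<epsilon> P) + \<beta> * (H_plus \<epsilon> P + H_minus \<epsilon> P))"
proof -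
  \<comment> \<open>For a minimiser \<open>c\<close>, the lower bound for every admissible policy is
    exactly the value of \<open>linear_policy c\<close>.\<close>
  obtain c where c: "\<And>k. threshold_cost \<epsilon> \<beta> c \<le> threshold_cost \<epsilon> \<beta> k"
    using threshold_cost_minimum[OF assms] by blast
  have "objective \<epsilon> \<beta> (linear_policy c) \<le> objective \<epsilon> \<beta> P" if "admissible \<epsilon> P" for P
    using objective_ge[OF assms that c] objective_linear_policy[OF assms, of c] by simp
  then show ?thesis
    using admissible_linear_policy[OF assms, of c] unfolding objective_def[OF assms] by blast
qed

end
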